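(* Let $d_0$ be the distance from $x_0$ to $S_*$. Let $(x_k,y_k,t_k)_{k\in\mathbb{N}}$ be the sequence generated by I-FISTA. Then, for all $k\in\mathbb{N}$, $$t_k^2\,(F(x_{k})-F^* )+\frac{\alpha}{2}\sum_{i=1}^{k}t_{i}^2\|y_{i}-x_{i}\|^2\leq \frac{L}{2\tau}d_0^2.$$ In particular, for all $k\in\mathbb{N}$, $$F(x_{k})-F^*\leq \frac{2L}{\tau (k+1)^2}d_0^2.$$
   Context: $\mathbb{N}=\{1,2,\dots\}$. $\mathbb{E}$ is a finite-dimensional real vector space with inner product $\langle\cdot,\cdot\rangle$ and induced norm $\|\cdot\|$. $f\colon\mathbb{E}\to\mathbb{R}$ is a differentiable convex function whose gradient is $L$-Lipschitz continuous, $L>0$; $g\colon\mathbb{E}\to\mathbb{R}\cup\{+\infty\}$ is a proper lower semicontinuous convex function; $F:=f+g$. $F^*:=\inf_{x\in\mathbb{E}}F(x)$ is assumed to be finite, and the set of minimizers $S_*$ of $F$ is assumed nonempty. For $\varepsilon\ge 0$ and $x\in\mathbb{E}$ (with $g(x)<+\infty$), $\partial_\varepsilon g(x):=\{u\in\mathbb{E}\mid g(y)\ge g(x)+\langle u,y-x\rangle-\varepsilon\ \ \forall y\in\mathbb{E}\}$ (empty if $g(x)=+\infty$). I-FISTA: let $x_0\in\mathbb{E}$, $\tau\in(0,1]$ and $\alpha\in[0,L(1-\tau)/\tau]$ be given. Set $y_1:=x_0$, $t_1:=1$, and for $k=1,2,\dots$ iterate: find any triple $(x_k,v_k,\varepsilon_k)\in\mathbb{E}\times\mathbb{E}\times[0,+\infty)$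 such that $$v_k\in\partial_{\varepsilon_k}g(x_k)+\frac{L}{\tau}(x_k-y_k)+\nabla f(y_k),\qquad \|\tau v_k\|^2+2\tau\varepsilon_kL\le L[(1-\tau)L-\alpha\tau]\,\|x_k-y_k\|^2,$$ and set $$t_{k+1}:=\frac{1+\sqrt{1+4t_k^2}}{2},\qquad y_{k+1}:=x_k-\Big(\frac{t_k}{t_{k+1}}\Big)\frac{\tau}{L}v_k+\Big(\frac{t_k-1}{t_{k+1}}\Big)(x_k-x_{k-1}).$$ *)

theory Defs
  imports "HOL-Analysis.Analysis"
begin

text \<open>Functions into \<open>\<real> \<union> {+\<infinity>}\<close> are represented as \<open>ereal\<close>-valued functions;
  properness excludes the value \<open>-\<infinity>\<close>.\<close>

definition proper :: "('a \<Rightarrow> ereal) \<Rightarrow> bool" where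
  "proper g \<longleftrightarrow> (\<forall>x. g x \<noteq> -\<infinity>) \<and> (\<exists>x. g x \<noteq> \<infinity>)"

definition lower_semicontinuous :: "('a::topological_space \<Rightarrow> ereal) \<Rightarrow> bool" where
  "lower_semicontinuous g \<longleftrightarrow> (\<forall>x. g x \<le> Liminf (at x) g)"

text \<open>The analogue of \<^const>\<open>convex_on\<close> for extended-valued functions. In \<open>ereal\<close> we
  have \<open>0 * \<infinity> = 0\<close>, so the cases \<open>u = 0\<close> and \<open>v = 0\<close> are harmless.\<close>

definition convex_ext :: "('a::real_vector \<Rightarrow> ereal) \<Rightarrow> bool" where
  "convex_ext g \<longleftrightarrow>
     (\<forall>x y. \<forall>u\<ge>0. \<forall>v\<ge>0. u + v = 1 \<longrightarrow>
        g (u *\<^sub>R x + v *\<^sub>R y) \<le> ereal u * g x + ereal v * g y)"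

definition eps_subdiff :: "real \<Rightarrow> ('a::real_inner \<Rightarrow> ereal) \<Rightarrow> 'a \<Rightarrow> 'a set" where
  "eps_subdiff \<epsilon> g x =
     {u. g x < \<infinity> \<and> (\<forall>y. g y \<ge> g x + ereal (u \<bullet> (y - x)) - ereal \<epsilon>)}"

definition objective :: "('a \<Rightarrow> real) \<Rightarrow> ('a \<Rightarrow> ereal) \<Rightarrow> 'a \<Rightarrow> ereal" where
  "objective f g x = ereal (f x) + g x"

definition minimizers :: "('a \<Rightarrow> ereal) \<Rightarrow> 'a set" where
  "minimizers F = {x. \<forall>z. F x \<le> F z}"

text \<open>The sequences form a run of I-FISTA started at \<open>x0\<close>; \<open>gradf\<close> is the gradient of the
  smooth part. The method starts at index 1: the values of \<open>y\<close>, \<open>v\<close>, \<open>\<epsilon>\<close> and \<open>t\<close> at 0 are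
  unconstrained and never used.\<close>

definition ifista ::
  "('a::real_inner \<Rightarrow> 'a) \<Rightarrow> ('a \<Rightarrow> ereal) \<Rightarrow> real \<Rightarrow> real \<Rightarrow> real \<Rightarrow> 'a \<Rightarrow>
   (nat \<Rightarrow> 'a) \<Rightarrow> (nat \<Rightarrow> 'a) \<Rightarrow> (nat \<Rightarrow> 'a) \<Rightarrow> (nat \<Rightarrow> real) \<Rightarrow> (nat \<Rightarrow> real) \<Rightarrow> bool" where
  "ifista gradf g L \<tau> \<alpha> x0 x y v \<epsilon> t \<longleftrightarrow>
     x 0 = x0 \<and> y 1 = x0 \<and> t 1 = 1 \<and>
     (\<forall>k\<ge>1.
        \<epsilon> k \<ge> 0 \<and>
        (\<exists>u \<in> eps_subdiff (\<epsilon> k) g (x k).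
            v k = u + (L / \<tau>) *\<^sub>R (x k - y k) + gradf (y k)) \<and>
        (norm (\<tau> *\<^sub>R v k))\<^sup>2 + 2 * \<tau> * \<epsilon> k * L
          \<le> L * ((1 - \<tau>) * L - \<alpha> * \<tau>) * (norm (x k - y k))\<^sup>2 \<and>
        t (k + 1) = (1 + sqrt (1 + 4 * (t k)\<^sup>2)) / 2 \<and>
        y (k + 1) = x k - (t k / t (k + 1) * (\<tau> / L)) *\<^sub>R v k
                        + ((t k - 1) / t (k + 1)) *\<^sub>R (x k - x (k - 1)))"

end

theory Submission
  imports Defs
begin

text \<open>
  Write \<open>w\<^sub>k = x\<^sub>k - (\<tau>/L) v\<^sub>k\<close>. The error criterion is exactly strong enough for the
  inexact proximal step from \<open>y\<^sub>k\<close> to satisfy the bound that drives the analysis of the exact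
  method, with \<open>w\<^sub>k\<close> as its end point in the distance term: for every \<open>z\<close>,

  \<open>F(x\<^sub>k) + (\<alpha>/2) \<parallel>y\<^sub>k - x\<^sub>k\<parallel>\<^sup>2 + (L/2\<tau>) \<parallel>w\<^sub>k - z\<parallel>\<^sup>2 \<le> F(z) + (L/2\<tau>) \<parallel>y\<^sub>k - z\<parallel>\<^sup>2\<close>

  (\<open>inexact_proximal_gradient_step\<close>). Taking for \<open>z\<close> the convex combination
  \<open>(1 - 1/t\<^sub>k) x\<^bsub>k-1\<^esub> + (1/t\<^sub>k) p\<close> with a minimizer \<open>p\<close> and multiplying by \<open>t\<^sub>k\<^sup>2\<close> gives a bound
  (\<open>accelerated_proximal_gradient_step\<close>) in which \<open>F(x\<^bsub>k-1\<^esub>) - F(p)\<close> has coefficient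
  \<open>t\<^sub>k\<^sup>2 - t\<^sub>k = t\<^bsub>k-1\<^esub>\<^sup>2\<close>. The choice of \<open>y\<^sub>k\<close> makes the distance terms of consecutive bounds match, so
  that they telescope (\<open>ifista_energy_bound\<close>), starting from \<open>(L/2\<tau>) \<parallel>x\<^sub>0 - p\<parallel>\<^sup>2\<close> because \<open>t\<^sub>1 = 1\<close>
  and \<open>y\<^sub>1 = x\<^sub>0\<close>. The infimum over \<open>p\<close> yields the first claim, and \<open>t\<^sub>k \<ge> (k + 1)/2\<close> the second.
\<close>

section \<open>Smooth convex functions\<close>

text \<open>Restricting to the segment from \<open>y\<close> to \<open>z\<close> turns both first-order bounds below into
  statements about a function of one real variable.\<close>

lemma GDERIV_along_segment:
  fixes f :: "'a::real_inner \<Rightarrow> real"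
  assumes "\<And>z. GDERIV f z :> gradf z"
  shows "((\<lambda>s. f (y + s *\<^sub>R d)) has_real_derivative gradf (y + s *\<^sub>R d) \<bullet> d) (at s)"
proof -
  have f': "(f has_derivative (\<lambda>h. h \<bullet> gradf (y + s *\<^sub>R d))) (at (y + s *\<^sub>R d))"
    using assms unfolding gderiv_def by blast
  have line: "((\<lambda>s. y + s *\<^sub>R d) has_derivative (\<lambda>h. h *\<^sub>R d)) (at s)"
    by (auto intro!: derivative_eq_intros)
  have "((\<lambda>s. f (y + s *\<^sub>R d)) has_derivative (\<lambda>h. (h *\<^sub>R d) \<bullet> gradf (y + s *\<^sub>R d))) (at s)"
    using has_derivative_compose[OF line f'] by simp
  then show ?thesis
    by (simp add: has_field_derivative_def inner_commute mult_commute_abs)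
qed

lemma convex_above_tangent:
  fixes f :: "'a::real_inner \<Rightarrow> real"
  assumes convex: "convex_on UNIV f" and grad: "\<And>z. GDERIV f z :> gradf z"
  shows "f z \<ge> f y + gradf y \<bullet> (z - y)"
proof -
  define \<phi> where "\<phi> s = f (y + s *\<^sub>R (z - y))" for s :: real
  have "convex_on UNIV \<phi>"
  proof (rule convex_onI)
    fix t a b :: real
    assume t: "0 < t" "t < 1"
    have "y + ((1 - t) *\<^sub>R a + t *\<^sub>R b) *\<^sub>R (z - y) =
        (1 - t) *\<^sub>R (y + a *\<^sub>R (z - y)) + t *\<^sub>R (y + b *\<^sub>R (z - y))"
      by (simp add: algebra_simps)
    then show "\<phi> ((1 - t) *\<^sub>R a + t *\<^sub>R b) \<le> (1 - t) * \<phi> a + t * \<phi> b"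
      unfolding \<phi>_def using convex_onD[OF convex, of t] t by simp
  qed auto
  moreover have "(\<phi> has_real_derivative gradf y \<bullet> (z - y)) (at 0)"
    using GDERIV_along_segment[OF grad, of y "z - y" 0] by (simp add: \<phi>_def[abs_def])
  ultimately have "\<phi> 1 - \<phi> 0 \<ge> (gradf y \<bullet> (z - y)) * (1 - 0)"
    using convex_on_imp_above_tangent[of UNIV \<phi> 0 1 "gradf y \<bullet> (z - y)"] by auto
  then show ?thesis
    by (simp add: \<phi>_def)
qed

text \<open>Along the segment, the difference between the two sides has the derivative
  \<open>(\<nabla>f(y + s d) - \<nabla>f(y)) \<bullet> d - L s \<parallel>d\<parallel>\<^sup>2\<close>, which the Lipschitz bound and Cauchy-Schwarz make
  nonpositive; so the difference decreases from its value \<open>0\<close> at \<open>s = 0\<close>.\<close>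

lemma lipschitz_gradient_upper_bound:
  fixes f :: "'a::real_inner \<Rightarrow> real"
  assumes grad: "\<And>z. GDERIV f z :> gradf z" and lip: "L-lipschitz_on UNIV gradf"
  shows "f x \<le> f y + gradf y \<bullet> (x - y) + L / 2 * (norm (x - y))\<^sup>2"
proof -
  define d where "d = x - y"
  define \<phi> where
    "\<phi> s = f (y + s *\<^sub>R d) - s * (gradf y \<bullet> d) - L / 2 * s\<^sup>2 * (norm d)\<^sup>2" for s :: real
  have "\<phi> 1 \<le> \<phi> 0"
  proof (rule DERIV_nonpos_imp_nonincreasing[where f = \<phi> and a = 0 and b = 1])
    fix s :: real
    assume s: "0 \<le> s"
    have "(\<phi> has_real_derivative
        (gradf (y + s *\<^sub>R d) \<bullet> d - gradf y \<bullet> d - L * s * (norm d)\<^sup>2)) (at s)"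
      unfolding \<phi>_def by (auto intro!: derivative_eq_intros GDERIV_along_segment[OF grad])
    moreover have "gradf (y + s *\<^sub>R d) \<bullet> d - gradf y \<bullet> d - L * s * (norm d)\<^sup>2 \<le> 0"
    proof -
      have "norm (gradf (y + s *\<^sub>R d) - gradf y) \<le> L * (s * norm d)"
        using lipschitz_onD[OF lip, of "y + s *\<^sub>R d" y] s by (simp add: dist_norm)
      then have "norm (gradf (y + s *\<^sub>R d) - gradf y) * norm d \<le> L * (s * norm d) * norm d"
        by (rule mult_right_mono) simp
      then have "(gradf (y + s *\<^sub>R d) - gradf y) \<bullet> d \<le> L * (s * norm d) * norm d"
        using norm_cauchy_schwarz order_trans by blast
      then show ?thesis
        by (simp add: inner_diff_left power2_eq_square algebra_simps)
    qed
    ultimately show "\<exists>D. (\<phi> has_real_derivative D) (at s) \<and> D \<le> 0"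
      by blast
  qed simp
  then show ?thesis
    by (simp add: \<phi>_def d_def)
qed

section \<open>The inexact proximal gradient step\<close>

text \<open>Add the tangent bound for \<open>f\<close> at \<open>y\<close>, the quadratic upper bound for \<open>f x\<close> and the
  \<open>\<epsilon>\<close>-subgradient inequality. The error criterion bounds \<open>\<epsilon>\<close> by
  \<open>((1 - \<tau>) L - \<alpha> \<tau>) \<parallel>x - y\<parallel>\<^sup>2 / (2 \<tau>) - \<tau> \<parallel>v\<parallel>\<^sup>2 / (2 L)\<close>. The term in \<open>\<parallel>v\<parallel>\<^sup>2\<close> is exactly
  the one that completes the square in \<open>x - (\<tau>/L) v - z\<close>, and what remains of the
  term in \<open>\<parallel>x - y\<parallel>\<^sup>2\<close> has coefficient \<open>\<alpha>/2\<close>.\<close>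

lemma inexact_proximal_gradient_step:
  fixes f :: "'a::real_inner \<Rightarrow> real"
  assumes convex: "convex_on UNIV f"
    and grad: "\<And>z. GDERIV f z :> gradf z"
    and lip: "L-lipschitz_on UNIV gradf"
    and pos: "L > 0" "\<tau> > 0"
    and u: "u \<in> eps_subdiff \<epsilon> g x"
    and v: "v = u + (L / \<tau>) *\<^sub>R (x - y) + gradf y"
    and err: "(norm (\<tau> *\<^sub>R v))\<^sup>2 + 2 * \<tau> * \<epsilon> * L
               \<le> L * ((1 - \<tau>) * L - \<alpha> * \<tau>) * (norm (x - y))\<^sup>2"
    and gx: "g x = ereal gx" and gz: "g z \<le> ereal gz"
  shows "f x + gx + \<alpha> / 2 * (norm (y - x))\<^sup>2
          + L / (2 * \<tau>) * (norm (x - (\<tau> / L) *\<^sub>R v - z))\<^sup>2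
        \<le> f z + gz + L / (2 * \<tau>) * (norm (y - z))\<^sup>2"
proof -
  have "ereal gx + ereal (u \<bullet> (z - x)) - ereal \<epsilon> \<le> ereal gz"
    using u gz unfolding eps_subdiff_def gx[symmetric] by (blast intro: order_trans)
  then have sub: "gx + u \<bullet> (z - x) - \<epsilon> \<le> gz"
    by simp
  have lower: "f y + gradf y \<bullet> (z - y) \<le> f z"
    using convex_above_tangent[OF convex grad] .
  have upper: "f x \<le> f y + gradf y \<bullet> (x - y) + L / 2 * (norm (x - y))\<^sup>2"
    using lipschitz_gradient_upper_bound[OF grad lip] .
  have eps: "\<epsilon> \<le> ((1 - \<tau>) * L - \<alpha> * \<tau>) * (norm (x - y))\<^sup>2 / (2 * \<tau>) - \<tau> * (norm v)\<^sup>2 / (2 * L)"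
  proof -
    have "\<tau>\<^sup>2 * (norm v)\<^sup>2 + 2 * \<tau> * \<epsilon> * L \<le> L * ((1 - \<tau>) * L - \<alpha> * \<tau>) * (norm (x - y))\<^sup>2"
      using err by (simp add: power_mult_distrib)
    then show ?thesis
      using pos by (simp add: field_simps power2_eq_square)
  qed
  have inner_u: "u \<bullet> (z - x) = v \<bullet> (z - x) + (L / \<tau>) * ((y - x) \<bullet> (z - x)) - gradf y \<bullet> (z - x)"
    unfolding v by (simp add: algebra_simps)
  have polar: "(y - x) \<bullet> (z - x) = ((norm (x - y))\<^sup>2 + (norm (x - z))\<^sup>2 - (norm (y - z))\<^sup>2) / 2"
    by (simp add: power2_norm_eq_inner inner_diff_left inner_diff_right inner_commute)
  have square: "(norm (x - (\<tau> / L) *\<^sub>R v - z))\<^sup>2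
      = (norm (x - z))\<^sup>2 + 2 * (\<tau> / L) * (v \<bullet> (z - x)) + (\<tau> / L)\<^sup>2 * (norm v)\<^sup>2"
    unfolding power2_norm_eq_inner
    by (simp add: inner_diff_left inner_diff_right inner_commute power2_eq_square algebra_simps
        diff_divide_distrib)
  have square': "L / (2 * \<tau>) * (norm (x - (\<tau> / L) *\<^sub>R v - z))\<^sup>2
      = L / (2 * \<tau>) * (norm (x - z))\<^sup>2 + v \<bullet> (z - x) + \<tau> * (norm v)\<^sup>2 / (2 * L)"
    unfolding square using pos by (simp add: field_simps power2_eq_square)
  have eps_split: "((1 - \<tau>) * L - \<alpha> * \<tau>) * (norm (x - y))\<^sup>2 / (2 * \<tau>)
      = L / (2 * \<tau>) * (norm (x - y))\<^sup>2 - L / 2 * (norm (x - y))\<^sup>2 - \<alpha> / 2 * (norm (x - y))\<^sup>2"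
    using pos by (simp add: field_simps)
  have polar': "(L / \<tau>) * ((y - x) \<bullet> (z - x))
      = L / (2 * \<tau>) * (norm (x - y))\<^sup>2 + L / (2 * \<tau>) * (norm (x - z))\<^sup>2
        - L / (2 * \<tau>) * (norm (y - z))\<^sup>2"
    unfolding polar using pos by (simp add: field_simps)
  have "gradf y \<bullet> (z - y) = gradf y \<bullet> (z - x) + gradf y \<bullet> (x - y)"
    by (simp add: inner_diff_right)
  then show ?thesis
    unfolding norm_minus_commute[of y x]
    using sub lower upper eps inner_u square' eps_split polar' by linarith
qed

text \<open>Testing the one-step bound at \<open>z = (1 - 1/s) q + (1/s) p\<close> and multiplying by \<open>s\<^sup>2\<close>: convexity
  splits the objective at \<open>z\<close>, and \<open>s (w - z) = s w - (s - 1) q - p\<close> for every \<open>w\<close>. For \<open>s = 1\<close> the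
  point \<open>q\<close> drops out and \<open>g q\<close> may be infinite; this covers the first iteration, where \<open>q\<close> is
  the starting point, which may lie outside the domain of \<open>g\<close>.\<close>

lemma accelerated_proximal_gradient_step:
  fixes f :: "'a::real_inner \<Rightarrow> real"
  assumes convex: "convex_on UNIV f"
    and grad: "\<And>z. GDERIV f z :> gradf z"
    and lip: "L-lipschitz_on UNIV gradf"
    and g_convex: "convex_ext g"
    and pos: "L > 0" "\<tau> > 0"
    and u: "u \<in> eps_subdiff \<epsilon> g x"
    and v: "v = u + (L / \<tau>) *\<^sub>R (x - y) + gradf y"
    and err: "(norm (\<tau> *\<^sub>R v))\<^sup>2 + 2 * \<tau> * \<epsilon> * L
               \<le> L * ((1 - \<tau>) * L - \<alpha> * \<tau>) * (norm (x - y))\<^sup>2"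
    and gx: "g x = ereal gx" and gp: "g p = ereal gp"
    and s: "s \<ge> 1" and gq: "s \<noteq> 1 \<Longrightarrow> g q = ereal gq"
  shows "s\<^sup>2 * (f x + gx - (f p + gp)) + \<alpha> / 2 * (s\<^sup>2 * (norm (y - x))\<^sup>2)
          + L / (2 * \<tau>) * (norm (s *\<^sub>R (x - (\<tau> / L) *\<^sub>R v) - (s - 1) *\<^sub>R q - p))\<^sup>2
        \<le> (s\<^sup>2 - s) * (f q + gq - (f p + gp))
          + L / (2 * \<tau>) * (norm (s *\<^sub>R y - (s - 1) *\<^sub>R q - p))\<^sup>2"
proof -
  define z where "z = (1 - 1 / s) *\<^sub>R q + (1 / s) *\<^sub>R p"
  define gz where "gz = (1 - 1 / s) * gq + (1 / s) * gp"
  have weights: "0 \<le> 1 - 1 / s" "0 \<le> 1 / s" "1 - 1 / s + 1 / s = 1"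
    using s by auto
  have "g z \<le> ereal (1 - 1 / s) * g q + ereal (1 / s) * g p"
    using g_convex weights unfolding convex_ext_def z_def by blast
  also have "\<dots> = ereal gz"
  proof (cases "s = 1")
    case True
    then show ?thesis by (simp add: gz_def gp zero_ereal_def[symmetric] one_ereal_def[symmetric])
  next
    case False
    then show ?thesis by (simp add: gz_def gp gq)
  qed
  finally have gz: "g z \<le> ereal gz" .
  have fz: "f z \<le> (1 - 1 / s) * f q + (1 / s) * f p"
    using convex_onD[OF convex, of "1 / s" q p] s unfolding z_def by simp
  have scale: "s\<^sup>2 * (norm (w - z))\<^sup>2 = (norm (s *\<^sub>R w - (s - 1) *\<^sub>R q - p))\<^sup>2" for w
  proof -
    have "s *\<^sub>R z = (s * (1 - 1 / s)) *\<^sub>R q + p"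
      using s by (simp add: z_def scaleR_add_right)
    then have "s *\<^sub>R z = (s - 1) *\<^sub>R q + p"
      using s by (simp add: right_diff_distrib)
    then have "s *\<^sub>R (w - z) = s *\<^sub>R w - (s - 1) *\<^sub>R q - p"
      by (simp add: scaleR_diff_right)
    then show ?thesis
      by (metis norm_scaleR power2_abs power_mult_distrib)
  qed
  have "f x + gx + \<alpha> / 2 * (norm (y - x))\<^sup>2
          + L / (2 * \<tau>) * (norm (x - (\<tau> / L) *\<^sub>R v - z))\<^sup>2
        \<le> ((1 - 1 / s) * f q + (1 / s) * f p) + gz + L / (2 * \<tau>) * (norm (y - z))\<^sup>2"
    using inexact_proximal_gradient_step[OF convex grad lip pos u v err gx gz] fz by linarith
  then have "s\<^sup>2 * (f x + gx + \<alpha> / 2 * (norm (y - x))\<^sup>2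
          + L / (2 * \<tau>) * (norm (x - (\<tau> / L) *\<^sub>R v - z))\<^sup>2)
        \<le> s\<^sup>2 * ((1 - 1 / s) * f q + (1 / s) * f p + gz + L / (2 * \<tau>) * (norm (y - z))\<^sup>2)"
    by (rule mult_left_mono) simp
  then have "s\<^sup>2 * (f x + gx) + \<alpha> / 2 * (s\<^sup>2 * (norm (y - x))\<^sup>2)
          + L / (2 * \<tau>) * (s\<^sup>2 * (norm (x - (\<tau> / L) *\<^sub>R v - z))\<^sup>2)
        \<le> s\<^sup>2 * ((1 - 1 / s) * f q + (1 / s) * f p + gz)
          + L / (2 * \<tau>) * (s\<^sup>2 * (norm (y - z))\<^sup>2)"
    by (simp only: distrib_left mult.left_commute[of "s\<^sup>2"])
  moreover have "s\<^sup>2 * ((1 - 1 / s) * f q + (1 / s) * f p + gz)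
      = (s\<^sup>2 - s) * (f q + gq) + s * (f p + gp)"
    using s by (simp add: gz_def field_simps power2_eq_square)
  ultimately show ?thesis
    unfolding scale by (simp add: algebra_simps)
qed

section \<open>The extrapolation parameters\<close>

lemma momentum_recurrence:
  fixes a b :: real
  assumes "b = (1 + sqrt (1 + 4 * a\<^sup>2)) / 2"
  shows "b\<^sup>2 - b = a\<^sup>2"
proof -
  have "(2 * b - 1)\<^sup>2 = 1 + 4 * a\<^sup>2"
    unfolding assms by (simp add: field_simps)
  then show ?thesis
    by (simp add: power2_eq_square algebra_simps)
qed

lemma momentum_growth:
  fixes a b :: real
  assumes "b = (1 + sqrt (1 + 4 * a\<^sup>2)) / 2"
  shows "b \<ge> a + 1 / 2"
proof -
  have "sqrt (1 + 4 * a\<^sup>2) \<ge> 2 * a"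
    by (rule real_le_rsqrt) (simp add: power2_eq_square)
  then show ?thesis
    using assms by simp
qed

lemma ifista_momentum_lower_bound:
  assumes run: "ifista gradf g L \<tau> \<alpha> x0 x y v \<epsilon> t" and "k \<ge> 1"
  shows "t k \<ge> (real k + 1) / 2"
  using \<open>k \<ge> 1\<close>
proof (induction k rule: dec_induct)
  case base
  then show ?case
    using run by (simp add: ifista_def)
next
  case (step k)
  have "t (Suc k) \<ge> t k + 1 / 2"
    using run step.hyps by (intro momentum_growth) (simp add: ifista_def)
  then show ?case
    using step.IH by simp
qed

section \<open>The energy estimate\<close>

text \<open>Membership in an \<open>\<epsilon>\<close>-subdifferential includes finiteness from above, so every iterate after
  the starting point lies in the domain of \<open>g\<close>.\<close>

lemma ifista_iterate_in_domain:
  assumes "ifista gradf g L \<tau> \<alpha> x0 x y v \<epsilon> t" and "proper g" and "k \<ge> 1"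
  shows "g (x k) = ereal (real_of_ereal (g (x k)))"
proof -
  have "g (x k) < \<infinity>"
    using assms(1,3) by (auto simp: ifista_def eps_subdiff_def)
  moreover have "g (x k) \<noteq> - \<infinity>"
    using assms(2) by (simp add: proper_def)
  ultimately show ?thesis
    by (cases "g (x k)") auto
qed

text \<open>The extrapolation is designed so that
  \<open>t\<^bsub>k+1\<^esub> y\<^bsub>k+1\<^esub> - (t\<^bsub>k+1\<^esub> - 1) x\<^sub>k = t\<^sub>k (x\<^sub>k - (\<tau>/L) v\<^sub>k) - (t\<^sub>k - 1) x\<^bsub>k-1\<^esub>\<close>, hence the distance term
  on the right of the step bound at index \<open>k + 1\<close> is the one on the left at index \<open>k\<close>. Since also
  \<open>t\<^bsub>k+1\<^esub>\<^sup>2 - t\<^bsub>k+1\<^esub> = t\<^sub>k\<^sup>2\<close>, the step bounds telescope.\<close>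

lemma ifista_energy_bound:
  fixes f :: "'a::real_inner \<Rightarrow> real"
  assumes convex: "convex_on UNIV f"
    and grad: "\<And>z. GDERIV f z :> gradf z"
    and lip: "L-lipschitz_on UNIV gradf"
    and g_proper: "proper g" and g_convex: "convex_ext g"
    and pos: "L > 0" "\<tau> > 0"
    and run: "ifista gradf g L \<tau> \<alpha> x0 x y v \<epsilon> t"
    and gp: "g p = ereal gp" and "k \<ge> 1"
  shows "(t k)\<^sup>2 * (f (x k) + real_of_ereal (g (x k)) - (f p + gp))
          + \<alpha> / 2 * (\<Sum>i=1..k. (t i)\<^sup>2 * (norm (y i - x i))\<^sup>2)
          + L / (2 * \<tau>) *
            (norm (t k *\<^sub>R (x k - (\<tau> / L) *\<^sub>R v k) - (t k - 1) *\<^sub>R x (k - 1) - p))\<^sup>2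
        \<le> L / (2 * \<tau>) * (norm (x0 - p))\<^sup>2"
proof -
  define \<delta> where "\<delta> k = f (x k) + real_of_ereal (g (x k)) - (f p + gp)" for k
  have one_step: "(t k)\<^sup>2 * \<delta> k + \<alpha> / 2 * ((t k)\<^sup>2 * (norm (y k - x k))\<^sup>2)
          + L / (2 * \<tau>) *
            (norm (t k *\<^sub>R (x k - (\<tau> / L) *\<^sub>R v k) - (t k - 1) *\<^sub>R x (k - 1) - p))\<^sup>2
        \<le> ((t k)\<^sup>2 - t k) * \<delta> (k - 1)
          + L / (2 * \<tau>) * (norm (t k *\<^sub>R y k - (t k - 1) *\<^sub>R x (k - 1) - p))\<^sup>2"
    if k: "k \<ge> 1" for k
  proof -
    obtain u where u: "u \<in> eps_subdiff (\<epsilon> k) g (x k)"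
        "v k = u + (L / \<tau>) *\<^sub>R (x k - y k) + gradf (y k)"
      and err: "(norm (\<tau> *\<^sub>R v k))\<^sup>2 + 2 * \<tau> * \<epsilon> k * L
          \<le> L * ((1 - \<tau>) * L - \<alpha> * \<tau>) * (norm (x k - y k))\<^sup>2"
      using run k unfolding ifista_def by blast
    have "t k \<ge> 1"
      using ifista_momentum_lower_bound[OF run k] k by simp
    moreover have "g (x (k - 1)) = ereal (real_of_ereal (g (x (k - 1))))" if "t k \<noteq> 1"
    proof -
      have "k \<noteq> 1"
        using that run by (auto simp: ifista_def)
      then show ?thesis
        using k by (intro ifista_iterate_in_domain[OF run g_proper]) simp
    qed
    ultimately show ?thesis
      unfolding \<delta>_def
      using accelerated_proximal_gradient_step[OF convex grad lip g_convex pos u err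
          ifista_iterate_in_domain[OF run g_proper k] gp]
      by blast
  qed
  show ?thesis
    unfolding \<delta>_def[symmetric] using \<open>k \<ge> 1\<close>
  proof (induction k rule: dec_induct)
    case base
    then show ?case
      using one_step[of 1] run by (simp add: ifista_def)
  next
    case (step k)
    have t: "t (Suc k) = (1 + sqrt (1 + 4 * (t k)\<^sup>2)) / 2"
      and y: "y (Suc k) = x k - (t k / t (Suc k) * (\<tau> / L)) *\<^sub>R v k
                + ((t k - 1) / t (Suc k)) *\<^sub>R (x k - x (k - 1))"
      using run step.hyps by (simp_all add: ifista_def)
    have "t (Suc k) > 0"
      using ifista_momentum_lower_bound[OF run, of "Suc k"] by simp
    then have "t (Suc k) *\<^sub>R y (Suc k)
        = t (Suc k) *\<^sub>R x k - (t k * (\<tau> / L)) *\<^sub>R v k + (t k - 1) *\<^sub>R (x k - x (k - 1))"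
      unfolding y by (simp add: scaleR_add_right scaleR_diff_right)
    then have "t (Suc k) *\<^sub>R y (Suc k) - (t (Suc k) - 1) *\<^sub>R x k
        = t k *\<^sub>R (x k - (\<tau> / L) *\<^sub>R v k) - (t k - 1) *\<^sub>R x (k - 1)"
      by (simp add: algebra_simps)
    then show ?case
      using one_step[of "Suc k"] step.IH momentum_recurrence[OF t]
      by (simp add: distrib_left)
  qed
qed

section \<open>Convergence rate\<close>

text \<open>Each minimizer yields an energy bound with its own distance to the starting point; taking square
  roots makes these bounds pass to the infimum of the distances.\<close>

lemma le_infdist_squared:
  fixes a C :: real
  assumes "S \<noteq> {}" and "C > 0" and "\<And>p. p \<in> S \<Longrightarrow> a \<le> C * (dist x p)\<^sup>2"
  shows "a \<le> C * (infdist x S)\<^sup>2"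
proof -
  have "sqrt (a / C) \<le> dist x p" if "p \<in> S" for p
    using assms(2) assms(3)[OF that] by (intro real_le_lsqrt) (auto simp: field_simps)
  then have "sqrt (a / C) \<le> infdist x S"
    using \<open>S \<noteq> {}\<close> by (auto simp: infdist_def intro!: cINF_greatest)
  then have "a / C \<le> (infdist x S)\<^sup>2"
    by (simp add: sqrt_le_D)
  then show ?thesis
    using \<open>C > 0\<close> by (simp add: field_simps)
qed

theorem theorem4p3:
  fixes f :: "'a::real_inner \<Rightarrow> real" and gradf :: "'a \<Rightarrow> 'a" and g :: "'a \<Rightarrow> ereal"
    and L \<tau> \<alpha> d0 :: real and Fstar :: ereal and x0 :: 'a
    and x y v :: "nat \<Rightarrow> 'a" and \<epsilon> t :: "nat \<Rightarrow> real"
  assumes finite_dim: "\<exists>B :: 'a set. finite B \<and> span B = UNIV"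
    and f_convex: "convex_on UNIV f"
    and f_grad: "\<And>z. GDERIV f z :> gradf z"
    and L_pos: "L > 0"
    and grad_lipschitz: "L-lipschitz_on UNIV gradf"
    and g_proper: "proper g"
    and g_lsc: "lower_semicontinuous g"
    and g_convex: "convex_ext g"
    and Fstar_def: "Fstar = (INF z. objective f g z)"
    and Fstar_finite: "\<bar>Fstar\<bar> \<noteq> \<infinity>"
    and minimizers_nonempty: "minimizers (objective f g) \<noteq> {}"
    and tau: "0 < \<tau>" "\<tau> \<le> 1"
    and alpha: "0 \<le> \<alpha>" "\<alpha> \<le> L * (1 - \<tau>) / \<tau>"
    and run: "ifista gradf g L \<tau> \<alpha> x0 x y v \<epsilon> t"
    and d0_def: "d0 = infdist x0 (minimizers (objective f g))"
  shows "(\<forall>k\<ge>1. ereal ((t k)\<^sup>2) * (objective f g (x k) - Fstar)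
                  + ereal (\<alpha> / 2 * (\<Sum>i=1..k. (t i)\<^sup>2 * (norm (y i - x i))\<^sup>2))
                \<le> ereal (L / (2 * \<tau>) * d0\<^sup>2)) \<and>
         (\<forall>k\<ge>1. objective f g (x k) - Fstar
                \<le> ereal (2 * L / (\<tau> * (real k + 1)\<^sup>2) * d0\<^sup>2))"
proof -
  define S where "S = minimizers (objective f g)"
  define C where "C = L / (2 * \<tau>)"
  define Fs where "Fs = real_of_ereal Fstar"
  define \<Phi> where "\<Phi> k = f (x k) + real_of_ereal (g (x k)) - Fs" for k
  define \<Sigma> where "\<Sigma> k = \<alpha> / 2 * (\<Sum>i=1..k. (t i)\<^sup>2 * (norm (y i - x i))\<^sup>2)" for k
  have C: "C > 0"
    using L_pos tau by (simp add: C_def)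
  have Fs: "Fstar = ereal Fs"
    using Fstar_finite by (auto simp: Fs_def ereal_real)
  have gap: "objective f g (x k) - Fstar = ereal (\<Phi> k)" if "k \<ge> 1" for k
  proof -
    have "g (x k) = ereal (real_of_ereal (g (x k)))"
      using ifista_iterate_in_domain[OF run g_proper that] .
    then have "objective f g (x k) = ereal (f (x k) + real_of_ereal (g (x k)))"
      unfolding objective_def by (metis plus_ereal.simps(1))
    then show ?thesis
      by (simp add: Fs \<Phi>_def)
  qed
  have energy: "(t k)\<^sup>2 * \<Phi> k + \<Sigma> k \<le> C * d0\<^sup>2" if k: "k \<ge> 1" for k
    unfolding d0_def S_def[symmetric]
  proof (rule le_infdist_squared)
    show "S \<noteq> {}"
      using minimizers_nonempty by (simp add: S_def)
    show "C > 0"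
      by (rule C)
    fix p
    assume "p \<in> S"
    then have "objective f g p = Fstar"
      unfolding S_def minimizers_def Fstar_def by (auto intro!: antisym INF_greatest INF_lower)
    then obtain gp where gp: "g p = ereal gp" and "f p + gp = Fs"
      using Fs unfolding objective_def by (cases "g p") auto
    then have "(t k)\<^sup>2 * \<Phi> k + \<Sigma> k
        + C * (norm (t k *\<^sub>R (x k - (\<tau> / L) *\<^sub>R v k) - (t k - 1) *\<^sub>R x (k - 1) - p))\<^sup>2
      \<le> C * (norm (x0 - p))\<^sup>2"
      using ifista_energy_bound[OF f_convex f_grad grad_lipschitz g_proper g_convex L_pos tau(1)
          run gp k]
      by (simp add: \<Phi>_def \<Sigma>_def C_def)
    moreover have
      "0 \<le> C * (norm (t k *\<^sub>R (x k - (\<tau> / L) *\<^sub>R v k) - (t k - 1) *\<^sub>R x (k - 1) - p))\<^sup>2"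
      using C by simp
    ultimately show "(t k)\<^sup>2 * \<Phi> k + \<Sigma> k \<le> C * (dist x0 p)\<^sup>2"
      by (simp add: dist_norm)
  qed
  have rate: "\<Phi> k \<le> 2 * L / (\<tau> * (real k + 1)\<^sup>2) * d0\<^sup>2" if k: "k \<ge> 1" for k
  proof -
    have "Fstar \<le> objective f g (x k)"
      unfolding Fstar_def by (rule INF_lower) simp
    then have "0 \<le> \<Phi> k"
      using gap[OF k] by (metis Fs ereal_diff_positive ereal_less_eq(5))
    moreover have "((real k + 1) / 2)\<^sup>2 \<le> (t k)\<^sup>2"
      using ifista_momentum_lower_bound[OF run k] by (intro power_mono) auto
    ultimately have "((real k + 1) / 2)\<^sup>2 * \<Phi> k \<le> (t k)\<^sup>2 * \<Phi> k"
      by (rule mult_right_mono[rotated])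
    also have "\<dots> \<le> C * d0\<^sup>2"
    proof -
      have "0 \<le> \<Sigma> k"
        using alpha(1) by (auto simp: \<Sigma>_def intro!: mult_nonneg_nonneg sum_nonneg)
      then show ?thesis
        using energy[OF k] by linarith
    qed
    finally have "\<Phi> k \<le> C * d0\<^sup>2 / ((real k + 1) / 2)\<^sup>2"
      by (subst pos_le_divide_eq) (auto simp: mult.commute)
    also have "\<dots> = 2 * L / (\<tau> * (real k + 1)\<^sup>2) * d0\<^sup>2"
      by (simp add: C_def power_divide)
    finally show ?thesis .
  qed
  show ?thesis
    using energy rate by (simp add: gap \<Sigma>_def C_def)
qed

end
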